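(* For any closed typed term $t:T$, either there exists a term $t'$ such that $t\mapsto_p t'$ (for some $p$) according to the call-by-name reduction strategy, or $t$ is a value.
   Context: Terms: $t ::= \mathtt{True}\mid\mathtt{False}\mid x\mid \lambda x.t\mid tu\mid \{p_1t_1,\ldots,p_nt_n\}\mid \circlearrowright_n t\mid \langle t_1,\ldots,t_n\rangle\mid t\pi_j\mid \mathtt{Trust}?\,t$, with $n,j\geq 1$ and $p_i$ rationals summing to $1$; $\mathtt{Trust}?\,t$ carries an annotation $\mathcal{P}(\varepsilon)$ ($\mathcal{P}=q_1B_1,\ldots,q_mB_m$ types with rational weights summing to 1, $\varepsilon$ rational). Free variables standard ($\lambda x$ binds $x$); closed = no free variables. Substitution $t[s/x]$: $x[s/x]=s$, $y[s/x]=y$ ($y\ne x$), constants unchanged, $(\lambda x.t)[s/x]=\lambda x.t$, $(\lambda y.t)[s/x]=\lambda y.t[s/x]$ ($y\ne x$), commuting with other constructors. Types: $A::= q\mid A\rightarrow B\mid \bigoplus_{i=1}^n A_i\mid (A)^n\mid \mathtt{Bool}(p_1B_1,\ldots,p_nB_n)(\varepsilon)$; $\bigoplus_{i=1}^1A_1$ identified with $A_1$. Subtyping $<:$: least reflexive transitive relation extending a given relation on atomic types with: $B_1<:A_1$, $A_2<:B_2$ imply $A_1\rightarrow A_2<:B_1\rightarrow B_2$; if each $A_j$ is a subtype of some $B_i$ then $\bigoplus_jA_j<:\bigoplus_iB_i$; $A<:B$, $m\ge n$ imply $(A)^m<:(B)^n$. Typing rules: $x:A$ for a variable of type $A$; $\mathtt{True},\mathtt{False}:\mathtt{Bool}\,\mathcal{P}(\varepsilon)$;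 $t:B$, $x:A$ give $\lambda x^A.t:A\rightarrow B$; $t_i:A_i$ (all $A_i$ subtypes of some $A$) give $\{p_1t_1,\ldots,p_nt_n\}:\bigoplus A_i$; $u:\bigoplus_{i=1}^n(C_i\rightarrow D_i)$, $v:C$ with $C<:C_i$ for all $i$ give $uv:\bigoplus D_i$; $t:A$ gives $\circlearrowright_nt:(A)^n$; $s_i:E_i$, $E_i<:E$ give $\langle s_1,\ldots,s_n\rangle:(E)^n$; $t:(A)^n$, $1\le j\le n$ give $t\pi_j:A$; $t:(A)^n$ gives $\mathtt{Trust}?\,t\,\mathcal{P}(\varepsilon):\mathtt{Bool}\,\mathcal{P}(\varepsilon)$. Values: $\mathtt{True}$, $\mathtt{False}$, $\lambda x.t$, and $\langle s_1,\ldots,s_n\rangle$ with all $s_i$ values. $\mathrm{D}_{\mathrm{TV}}(\mathcal{P}\parallel\mathcal{P}')$: $1$ if neither type set of $\mathcal{P},\mathcal{P}'$ contains the other; otherwise $\max_i|q_i-q'_i|$ over types $S_i$ in the union, with $q_i,q'_i$ the total weights of $S_i$ in $\mathcal{P},\mathcal{P}'$ (or 0). $\langle s_1,\ldots,s_n\rangle\approx q_1B_1,\ldots,q_mB_m$ iff all $s_i$ are values and for each $j$ exactly $q_j\cdot n$ of the types of the $s_i$ are subtypes of $B_j$. Basic reduction rules: $(\lambda x.t)u\mapsto_1 t[u/x]$; $\{p_1t_1,\ldots,p_nt_n\}\mapsto_{p_i}t_i$ ($1\le i\le n$); $\circlearrowright_ns\mapsto_1\langle s,\ldots,s\rangle$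 ($n$ copies); $\langle s_1,\ldots,s_n\rangle\pi_i\mapsto_1 s_i$; $\mathtt{Trust}?\langle s_1,\ldots,s_n\rangle\mathcal{P}(\varepsilon)\mapsto_1\mathtt{True}$ (resp. $\mathtt{False}$) if $\langle s_1,\ldots,s_n\rangle\approx\mathcal{P}'$ and $\mathrm{D}_{\mathrm{TV}}(\mathcal{P}\parallel\mathcal{P}')\le\varepsilon$ (resp. $>\varepsilon$). Call-by-name strategy: the relation $\mapsto_p$ generated by the basic rules together with: if $t\mapsto_pt'$ then $ts\mapsto_pt's$; if $t\mapsto_pt'$ and $t$ is the leftmost element of $\langle\ldots,t,\ldots\rangle$ that is not a value, then $\langle\ldots,t,\ldots\rangle\mapsto_p\langle\ldots,t',\ldots\rangle$; if $t\mapsto_pt'$ then $\mathtt{Trust}?\,t\,\mathcal{P}(\varepsilon)\mapsto_p\mathtt{Trust}?\,t'\,\mathcal{P}(\varepsilon)$; if $t\mapsto_pt'$ and $t$ is not of the form $\langle t_1,\ldots,t_m\rangle$ then $t\pi_j\mapsto_pt'\pi_j$. *)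

theory Defs
  imports Complex_Main
begin

text \<open>
  Syntax is given by raw datatypes together with well-formedness predicates carrying the side
  conditions of the grammar (weights summing to 1, indices at least 1). Typing and subtyping only
  ever relate well-formed objects; see \<open>subty_wf\<close> and \<open>has_ty_wf\<close> below.
\<close>

section \<open>Types\<close>

text \<open>
  The one-summand sum is identified with its summand. Types are therefore represented by normal
  forms: the constructor \<open>SumT A B Cs\<close> is the sum of the at least two summands \<open>A # B # Cs\<close>, and
  sums of arbitrary positive length are formed with \<open>oplus\<close>.
\<close>

datatype 'q ty =
    Atom 'q
  | Arr "'q ty" "'q ty" (infixr "\<rightarrow>\<^sub>t" 60)
  | SumT "'q ty" "'q ty" "'q ty list"
  | PowT "'q ty" nat
  | BoolT "(rat \<times> 'q ty) list" rat

type_synonym 'q dist = "(rat \<times> 'q ty) list"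

fun oplus :: "'q ty list \<Rightarrow> 'q ty" where
  "oplus [A] = A"
| "oplus (A # B # Cs) = SumT A B Cs"

inductive wf_ty :: "'q ty \<Rightarrow> bool" where
  "wf_ty (Atom q)"
| "wf_ty A \<Longrightarrow> wf_ty B \<Longrightarrow> wf_ty (A \<rightarrow>\<^sub>t B)"
| "wf_ty A \<Longrightarrow> wf_ty B \<Longrightarrow> \<forall>C \<in> set Cs. wf_ty C \<Longrightarrow> wf_ty (SumT A B Cs)"
| "wf_ty A \<Longrightarrow> 1 \<le> n \<Longrightarrow> wf_ty (PowT A n)"
| "(\<Sum>(q, B) \<leftarrow> P. q) = 1 \<Longrightarrow> \<forall>(q, B) \<in> set P. wf_ty B \<Longrightarrow> wf_ty (BoolT P \<epsilon>)"

definition wf_dist :: "'q dist \<Rightarrow> bool" where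
  "wf_dist P \<longleftrightarrow> (\<Sum>(q, B) \<leftarrow> P. q) = 1 \<and> (\<forall>(q, B) \<in> set P. wf_ty B)"

text \<open>\<open>R\<close> is the given relation on atomic types.\<close>

inductive subty :: "('q \<Rightarrow> 'q \<Rightarrow> bool) \<Rightarrow> 'q ty \<Rightarrow> 'q ty \<Rightarrow> bool" for R where
  sub_refl: "wf_ty A \<Longrightarrow> subty R A A"
| sub_trans: "subty R A B \<Longrightarrow> subty R B C \<Longrightarrow> subty R A C"
| sub_atom: "R q q' \<Longrightarrow> subty R (Atom q) (Atom q')"
| sub_arr: "subty R B1 A1 \<Longrightarrow> subty R A2 B2 \<Longrightarrow> subty R (A1 \<rightarrow>\<^sub>t A2) (B1 \<rightarrow>\<^sub>t B2)"
| sub_sum: "As \<noteq> [] \<Longrightarrow> Bs \<noteq> [] \<Longrightarrow> \<forall>B \<in> set Bs. wf_ty B \<Longrightarrow>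
    \<forall>A \<in> set As. \<exists>B \<in> set Bs. subty R A B \<Longrightarrow> subty R (oplus As) (oplus Bs)"
| sub_pow: "subty R A B \<Longrightarrow> n \<le> m \<Longrightarrow> 1 \<le> n \<Longrightarrow> subty R (PowT A m) (PowT B n)"

section \<open>Terms\<close>

text \<open>Variables are typed a la Church: \<open>(x, A)\<close> is the variable of type \<open>A\<close> with name \<open>x\<close>.\<close>

type_synonym 'q var = "nat \<times> 'q ty"

datatype 'q tm =
    TrueC
  | FalseC
  | Var "'q var"
  | Lam "'q var" "'q tm"
  | App "'q tm" "'q tm"
  | Choice "(rat \<times> 'q tm) list"
  | Copy nat "'q tm"
  | Tuple "'q tm list"
  | Proj "'q tm" nat
  | Trust "'q tm" "'q dist" rat

inductive wf_tm :: "'q tm \<Rightarrow> bool" where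
  "wf_tm TrueC"
| "wf_tm FalseC"
| "wf_ty A \<Longrightarrow> wf_tm (Var (x, A))"
| "wf_ty A \<Longrightarrow> wf_tm t \<Longrightarrow> wf_tm (Lam (x, A) t)"
| "wf_tm t \<Longrightarrow> wf_tm u \<Longrightarrow> wf_tm (App t u)"
| "(\<Sum>(p, t) \<leftarrow> ps. p) = 1 \<Longrightarrow> \<forall>(p, t) \<in> set ps. wf_tm t \<Longrightarrow> wf_tm (Choice ps)"
| "wf_tm t \<Longrightarrow> 1 \<le> n \<Longrightarrow> wf_tm (Copy n t)"
| "ts \<noteq> [] \<Longrightarrow> \<forall>t \<in> set ts. wf_tm t \<Longrightarrow> wf_tm (Tuple ts)"
| "wf_tm t \<Longrightarrow> 1 \<le> j \<Longrightarrow> wf_tm (Proj t j)"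
| "wf_tm t \<Longrightarrow> wf_dist P \<Longrightarrow> wf_tm (Trust t P \<epsilon>)"

fun fv :: "'q tm \<Rightarrow> 'q var set" where
  "fv TrueC = {}"
| "fv FalseC = {}"
| "fv (Var x) = {x}"
| "fv (Lam x t) = fv t - {x}"
| "fv (App t u) = fv t \<union> fv u"
| "fv (Choice ps) = (\<Union>(p, t) \<in> set ps. fv t)"
| "fv (Copy n t) = fv t"
| "fv (Tuple ts) = (\<Union>t \<in> set ts. fv t)"
| "fv (Proj t j) = fv t"
| "fv (Trust t P \<epsilon>) = fv t"

definition closed_tm :: "'q tm \<Rightarrow> bool" where
  "closed_tm t \<longleftrightarrow> fv t = {}"

text \<open>\<open>subst t s x\<close> is \<open>t[s/x]\<close>; as in the source, bound variables are not renamed.\<close>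

fun subst :: "'q tm \<Rightarrow> 'q tm \<Rightarrow> 'q var \<Rightarrow> 'q tm" where
  "subst TrueC s x = TrueC"
| "subst FalseC s x = FalseC"
| "subst (Var y) s x = (if y = x then s else Var y)"
| "subst (Lam y t) s x = (if y = x then Lam y t else Lam y (subst t s x))"
| "subst (App t u) s x = App (subst t s x) (subst u s x)"
| "subst (Choice ps) s x = Choice (map (\<lambda>(p, t). (p, subst t s x)) ps)"
| "subst (Copy n t) s x = Copy n (subst t s x)"
| "subst (Tuple ts) s x = Tuple (map (\<lambda>t. subst t s x) ts)"
| "subst (Proj t j) s x = Proj (subst t s x) j"
| "subst (Trust t P \<epsilon>) s x = Trust (subst t s x) P \<epsilon>"

section \<open>Typing\<close>

inductive has_ty :: "('q \<Rightarrow> 'q \<Rightarrow> bool) \<Rightarrow> 'q tm \<Rightarrow> 'q ty \<Rightarrow> bool" for R where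
  ty_var: "wf_ty A \<Longrightarrow> has_ty R (Var (x, A)) A"
| ty_true: "wf_dist P \<Longrightarrow> has_ty R TrueC (BoolT P \<epsilon>)"
| ty_false: "wf_dist P \<Longrightarrow> has_ty R FalseC (BoolT P \<epsilon>)"
| ty_lam: "wf_ty A \<Longrightarrow> has_ty R t B \<Longrightarrow> has_ty R (Lam (x, A) t) (A \<rightarrow>\<^sub>t B)"
| ty_choice: "(\<Sum>(p, t) \<leftarrow> ps. p) = 1 \<Longrightarrow> list_all2 (has_ty R) (map snd ps) As \<Longrightarrow>
    \<forall>Ai \<in> set As. subty R Ai A \<Longrightarrow> has_ty R (Choice ps) (oplus As)"
| ty_app: "CDs \<noteq> [] \<Longrightarrow> has_ty R u (oplus (map (\<lambda>(Ci, Di). Ci \<rightarrow>\<^sub>t Di) CDs)) \<Longrightarrow>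
    has_ty R v C \<Longrightarrow> \<forall>(Ci, Di) \<in> set CDs. subty R C Ci \<Longrightarrow>
    has_ty R (App u v) (oplus (map snd CDs))"
| ty_copy: "has_ty R t A \<Longrightarrow> 1 \<le> n \<Longrightarrow> has_ty R (Copy n t) (PowT A n)"
| ty_tuple: "ss \<noteq> [] \<Longrightarrow> list_all2 (has_ty R) ss Es \<Longrightarrow> \<forall>Ei \<in> set Es. subty R Ei E \<Longrightarrow>
    has_ty R (Tuple ss) (PowT E (length ss))"
| ty_proj: "has_ty R t (PowT A n) \<Longrightarrow> 1 \<le> j \<Longrightarrow> j \<le> n \<Longrightarrow> has_ty R (Proj t j) A"
| ty_trust: "has_ty R t (PowT A n) \<Longrightarrow> wf_dist P \<Longrightarrow> has_ty R (Trust t P \<epsilon>) (BoolT P \<epsilon>)"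

section \<open>Values, distributions and reduction\<close>

inductive is_value :: "'q tm \<Rightarrow> bool" where
  "is_value TrueC"
| "is_value FalseC"
| "is_value (Lam x t)"
| "\<forall>s \<in> set ss. is_value s \<Longrightarrow> is_value (Tuple ss)"

definition types_of :: "'q dist \<Rightarrow> 'q ty set" where
  "types_of P = snd ` set P"

definition weight :: "'q dist \<Rightarrow> 'q ty \<Rightarrow> rat" where
  "weight P S = (\<Sum>(q, B) \<leftarrow> P. if B = S then q else 0)"

definition D_TV :: "'q dist \<Rightarrow> 'q dist \<Rightarrow> rat" where
  "D_TV P P' =
    (if \<not> types_of P \<subseteq> types_of P' \<and> \<not> types_of P' \<subseteq> types_of P then 1
     else Max ((\<lambda>S. \<bar>weight P S - weight P' S\<bar>) ` (types_of P \<union> types_of P')))"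

text \<open>
  A term can have several types (e.g. the constants have every Boolean type), so \<open>the types of the
  components\<close> is read as some assignment \<open>As\<close> of one type to each component.
\<close>

definition approx_dist :: "('q \<Rightarrow> 'q \<Rightarrow> bool) \<Rightarrow> 'q tm list \<Rightarrow> 'q dist \<Rightarrow> bool" where
  "approx_dist R ss P \<longleftrightarrow> wf_dist P \<and> (\<forall>s \<in> set ss. is_value s) \<and>
    (\<exists>As. list_all2 (has_ty R) ss As \<and>
      (\<forall>(q, B) \<in> set P.
        rat_of_nat (card {i. i < length As \<and> subty R (As ! i) B}) = q * rat_of_nat (length ss)))"

inductive basic_red :: "('q \<Rightarrow> 'q \<Rightarrow> bool) \<Rightarrow> 'q tm \<Rightarrow> rat \<Rightarrow> 'q tm \<Rightarrow> bool" for R where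
  "basic_red R (App (Lam x t) u) 1 (subst t u x)"
| "(p, t) \<in> set ps \<Longrightarrow> basic_red R (Choice ps) p t"
| "basic_red R (Copy n s) 1 (Tuple (replicate n s))"
| "1 \<le> i \<Longrightarrow> i \<le> length ss \<Longrightarrow> basic_red R (Proj (Tuple ss) i) 1 (ss ! (i - 1))"
| "approx_dist R ss P' \<Longrightarrow> D_TV P P' \<le> \<epsilon> \<Longrightarrow> basic_red R (Trust (Tuple ss) P \<epsilon>) 1 TrueC"
| "approx_dist R ss P' \<Longrightarrow> D_TV P P' > \<epsilon> \<Longrightarrow> basic_red R (Trust (Tuple ss) P \<epsilon>) 1 FalseC"

inductive cbn_red :: "('q \<Rightarrow> 'q \<Rightarrow> bool) \<Rightarrow> 'q tm \<Rightarrow> rat \<Rightarrow> 'q tm \<Rightarrow> bool" for R where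
  cbn_basic: "basic_red R t p t' \<Longrightarrow> cbn_red R t p t'"
| cbn_app: "cbn_red R t p t' \<Longrightarrow> cbn_red R (App t s) p (App t' s)"
| cbn_tuple: "cbn_red R t p t' \<Longrightarrow> \<forall>v \<in> set vs. is_value v \<Longrightarrow> \<not> is_value t \<Longrightarrow>
    cbn_red R (Tuple (vs @ t # ss)) p (Tuple (vs @ t' # ss))"
| cbn_trust: "cbn_red R t p t' \<Longrightarrow> cbn_red R (Trust t P \<epsilon>) p (Trust t' P \<epsilon>)"
| cbn_proj: "cbn_red R t p t' \<Longrightarrow> \<nexists>ts. t = Tuple ts \<Longrightarrow> cbn_red R (Proj t j) p (Proj t' j)"

section \<open>Well-formedness is respected\<close>

lemma wf_ty_oplus: "As \<noteq> [] \<Longrightarrow> wf_ty (oplus As) \<longleftrightarrow> (\<forall>A \<in> set As. wf_ty A)"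
  by (cases As rule: oplus.cases) (auto intro: wf_ty.intros elim: wf_ty.cases)

lemma subty_wf: "subty R A B \<Longrightarrow> wf_ty A \<and> wf_ty B"
  by (induction rule: subty.induct) (auto simp: wf_ty_oplus intro: wf_ty.intros)

lemma wf_ty_ArrD: "wf_ty (A \<rightarrow>\<^sub>t B) \<Longrightarrow> wf_ty A \<and> wf_ty B"
  by (auto elim: wf_ty.cases)

lemma wf_ty_PowD: "wf_ty (PowT A n) \<Longrightarrow> wf_ty A \<and> 1 \<le> n"
  by (auto elim: wf_ty.cases)

lemma list_all2_setD: "list_all2 Q xs ys \<Longrightarrow> x \<in> set xs \<Longrightarrow> \<exists>y \<in> set ys. Q x y"
  by (induction rule: list_all2_induct) auto

lemma has_ty_wf: "has_ty R t A \<Longrightarrow> wf_tm t \<and> wf_ty A"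
proof (induction rule: has_ty.induct)
  case (ty_choice ps As A)
  have "As \<noteq> []" using ty_choice by auto
  moreover have "\<forall>(p, t) \<in> set ps. wf_tm t"
    using ty_choice.IH by (fastforce simp: list_all2_map1 dest: list_all2_setD)
  ultimately show ?case using ty_choice.hyps
    by (auto simp: wf_ty_oplus intro!: wf_tm.intros dest: subty_wf)
next
  case (ty_app CDs u v C)
  then show ?case
    by (fastforce simp: wf_ty_oplus dest: wf_ty_ArrD intro: wf_tm.intros)
next
  case (ty_tuple ss Es E)
  have "\<forall>t \<in> set ss. wf_tm t"
    using ty_tuple.IH by (fastforce dest: list_all2_setD)
  moreover have "wf_ty E"
    using ty_tuple by (cases Es) (auto dest: subty_wf)
  ultimately show ?case using ty_tuple.hyps
    by (cases ss) (auto intro!: wf_tm.intros wf_ty.intros)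
qed (auto simp: wf_dist_def intro!: wf_tm.intros wf_ty.intros dest: wf_ty_PowD)

end

theory Submission imports Defs begin

text \<open>
  Progress by induction on the typing derivation. A \<open>Trust\<close> redex always fires because a tuple
  of values typed at \<open>PowT E n\<close> approximates the one-point distribution \<open>[(1, E)]\<close>: the types of
  all its components are subtypes of \<open>E\<close>.
\<close>

inductive_cases is_value_Tuple_elim: "is_value (Tuple ts)"

inductive_cases wf_tm_Lam_elim: "wf_tm (Lam x t)"
inductive_cases wf_tm_App_elim: "wf_tm (App t u)"
inductive_cases wf_tm_Choice_elim: "wf_tm (Choice ps)"
inductive_cases wf_tm_Copy_elim: "wf_tm (Copy n t)"
inductive_cases wf_tm_Tuple_elim: "wf_tm (Tuple ts)"
inductive_cases wf_tm_Proj_elim: "wf_tm (Proj t j)"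
inductive_cases wf_tm_Trust_elim: "wf_tm (Trust t P e)"

inductive_cases has_ty_True_elim: "has_ty R TrueC T"
inductive_cases has_ty_False_elim: "has_ty R FalseC T"
inductive_cases has_ty_Lam_elim: "has_ty R (Lam x t) T"
inductive_cases has_ty_Tuple_elim: "has_ty R (Tuple ts) T"

lemma wf_tm_subst: "wf_tm t \<Longrightarrow> wf_tm s \<Longrightarrow> wf_tm (subst t s x)"
proof (induction rule: wf_tm.induct)
  case (6 ps)
  \<comment> \<open>Case \<open>6\<close> is \<open>Choice\<close>: substitution acts on the
    alternatives only and keeps the weights, so their sum stays 1.\<close>
  have "(\<Sum>(p, t) \<leftarrow> map (\<lambda>(p, t). (p, subst t s x)) ps. p) = (\<Sum>(p, t) \<leftarrow> ps. p)"
    by (simp add: comp_def case_prod_unfold)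
  with 6 show ?case
    by (auto intro!: wf_tm.intros)
qed (auto intro!: wf_tm.intros)

lemma basic_red_wf_tm: "basic_red R t p t' \<Longrightarrow> wf_tm t \<Longrightarrow> wf_tm t'"
  by (induction rule: basic_red.induct)
    (auto intro!: wf_tm.intros wf_tm_subst elim!: wf_tm_Lam_elim wf_tm_App_elim
      wf_tm_Choice_elim wf_tm_Copy_elim wf_tm_Tuple_elim wf_tm_Proj_elim)

text \<open>Terms are raw syntax, so this ensures that the reduct found by progress is a term of the
  grammar. No subject reduction is involved.\<close>

lemma cbn_red_wf_tm: "cbn_red R t p t' \<Longrightarrow> wf_tm t \<Longrightarrow> wf_tm t'"
  by (induction rule: cbn_red.induct)
    (auto intro!: wf_tm.intros dest: basic_red_wf_tm elim!: wf_tm_App_elim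
      wf_tm_Tuple_elim wf_tm_Proj_elim wf_tm_Trust_elim)

lemma oplus_arrows_neq:
  assumes "CDs \<noteq> []"
  shows "oplus (map (\<lambda>(C, D). C \<rightarrow>\<^sub>t D) CDs) \<noteq> BoolT P \<epsilon>"
    and "oplus (map (\<lambda>(C, D). C \<rightarrow>\<^sub>t D) CDs) \<noteq> PowT A n"
  \<comment> \<open>\<open>remdups_adj.cases\<close> serves only to split into zero, one, or at
    least two elements, as \<open>oplus\<close> does: one summand gives an arrow, more give a
    \<open>SumT\<close>.\<close>
  using assms by (cases CDs rule: remdups_adj.cases; auto split: prod.splits)+

text \<open>Canonical forms: typing has no subsumption rule, so constants only get Boolean types and
  tuples only power types.\<close>

lemma value_of_oplus_arrows_is_Lam:
  assumes "is_value u" "CDs \<noteq> []" "has_ty R u (oplus (map (\<lambda>(C, D). C \<rightarrow>\<^sub>t D) CDs))"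
  shows "\<exists>x t. u = Lam x t"
  using assms
  by (cases rule: is_value.cases)
    (auto simp: oplus_arrows_neq elim: has_ty_True_elim has_ty_False_elim has_ty_Tuple_elim)

lemma value_of_PowT_is_Tuple:
  assumes "is_value t" "has_ty R t (PowT A n)"
  shows "\<exists>ss. t = Tuple ss"
  using assms
  by (cases rule: is_value.cases)
    (auto elim: has_ty_True_elim has_ty_False_elim has_ty_Lam_elim)

lemma value_Tuple_approx_dist:
  assumes "is_value (Tuple ss)" "has_ty R (Tuple ss) (PowT E n)"
  shows "approx_dist R ss [(1, E)]"
proof -
  obtain Es where Es: "list_all2 (has_ty R) ss Es" "\<forall>Ei \<in> set Es. subty R Ei E"
    using assms(2) by (auto elim: has_ty_Tuple_elim)
  have "{i. i < length Es \<and> subty R (Es ! i) E} = {..<length Es}"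
    using Es(2) by auto
  moreover have "length Es = length ss"
    using Es(1) by (simp add: list_all2_lengthD)
  ultimately have "\<exists>As. list_all2 (has_ty R) ss As \<and>
      card {i. i < length As \<and> subty R (As ! i) E} = length ss"
    \<comment> \<open>A value may have several types; the ones from the typing derivation of the
      tuple are chosen, and all of them are counted.\<close>
    using Es(1) by (intro exI[of _ Es]) simp
  moreover have "wf_ty E"
    using has_ty_wf[OF assms(2)] wf_ty_PowD by blast
  moreover have "\<forall>s \<in> set ss. is_value s"
    using assms(1) by (rule is_value_Tuple_elim)
  ultimately show ?thesis
    by (simp add: approx_dist_def wf_dist_def)
qed

text \<open>Splitting at the first non-value leaves a prefix of values, as the leftmost strategy
  demands.\<close>

lemma cbn_red_Tuple:
  assumes "\<forall>s \<in> set ss. is_value s \<or> (\<exists>p s'. cbn_red R s p s')"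
    and "\<not> is_value (Tuple ss)"
  shows "\<exists>p t'. cbn_red R (Tuple ss) p t'"
proof -
  have "\<exists>s \<in> set ss. \<not> is_value s"
    using assms(2) by (auto intro: is_value.intros)
  then obtain vs s us where ss: "ss = vs @ s # us" and "\<not> is_value s" "\<forall>v \<in> set vs. is_value v"
    using split_list_first_prop[of ss "\<lambda>s. \<not> is_value s"] by blast
  moreover obtain p s' where "cbn_red R s p s'"
    using assms(1) ss \<open>\<not> is_value s\<close> by auto
  ultimately show ?thesis
    by (blast intro: cbn_tuple)
qed

lemma progress:
  assumes "has_ty R t T" "closed_tm t"
  shows "(\<exists>p t'. cbn_red R t p t') \<or> is_value t"
  using assms
proof (induction rule: has_ty.induct)
  case (ty_var A x)
  then show ?case by (simp add: closed_tm_def)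
next
  case (ty_choice ps As A)
  \<comment> \<open>An empty choice would have total weight 0 instead of 1.\<close>
  then obtain p t where "(p, t) \<in> set ps"
    by (cases ps) auto
  then show ?case
    by (blast intro: cbn_basic basic_red.intros)
next
  case (ty_app CDs u v C)
  show ?case
  proof (cases "is_value u")
    case True
    then obtain x s where "u = Lam x s"
      using value_of_oplus_arrows_is_Lam ty_app.hyps by blast
    then show ?thesis
      by (blast intro: cbn_basic basic_red.intros)
  next
    case False
    then show ?thesis
      using ty_app by (auto simp: closed_tm_def intro: cbn_app)
  qed
next
  case (ty_copy t A n)
  show ?case by (blast intro: cbn_basic basic_red.intros)
next
  case (ty_tuple ss Es E)
  have "\<forall>s \<in> set ss. is_value s \<or> (\<exists>p s'. cbn_red R s p s')"
    using list_all2_setD[OF ty_tuple.IH] ty_tuple.prems by (fastforce simp: closed_tm_def)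
  then show ?case
    using cbn_red_Tuple by blast
next
  case (ty_proj t A n j)
  show ?case
  \<comment> \<open>The split is on tuple form, not on being a value: \<open>cbn_proj\<close> never
    reduces inside a tuple, so even an unevaluated one is projected at once.\<close>
  proof (cases "\<exists>ss. t = Tuple ss")
    case True
    then obtain ss where "t = Tuple ss" ..
    \<comment> \<open>Inversion fixes the exponent as the tuple length, so \<open>j\<close> is in
      range.\<close>
    moreover have "length ss = n"
      using ty_proj.hyps(1) \<open>t = Tuple ss\<close> by (auto elim: has_ty_Tuple_elim)
    ultimately show ?thesis
      using ty_proj.hyps by (blast intro: cbn_basic basic_red.intros)
  next
    case False
    then have "\<not> is_value t"
      using value_of_PowT_is_Tuple ty_proj.hyps(1) by blast
    with False ty_proj show ?thesis
      by (auto simp: closed_tm_def intro: cbn_proj)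
  qed
next
  case (ty_trust t A n P \<epsilon>)
  show ?case
  proof (cases "is_value t")
    case True
    then obtain ss where t: "t = Tuple ss"
      using value_of_PowT_is_Tuple ty_trust.hyps(1) by blast
    then have "approx_dist R ss [(1, A)]"
      using value_Tuple_approx_dist True ty_trust.hyps(1) by blast
    \<comment> \<open>The order on the rationals is total, so one of the two \<open>Trust\<close>
      rules applies whatever the distance is.\<close>
    then show ?thesis
      unfolding t by (meson cbn_basic basic_red.intros(5,6) not_le)
  next
    case False
    then show ?thesis
      using ty_trust by (auto simp: closed_tm_def intro: cbn_trust)
  qed
\<comment> \<open>Constants and abstractions are values outright; nothing is reduced under a
  binder.\<close>
qed (auto intro: is_value.intros)

theorem mainTheorem4:
  fixes R :: "'q \<Rightarrow> 'q \<Rightarrow> bool" and t :: "'q tm" and T :: "'q ty"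
  assumes "closed_tm t" and "has_ty R t T"
  shows "(\<exists>p t'. wf_tm t' \<and> cbn_red R t p t') \<or> is_value t"
  using progress[OF assms(2,1)] cbn_red_wf_tm has_ty_wf[OF assms(2)] by blast

end
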